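(* Let $\widehat{\mathcal{Z}}$ be the set of positive integers that can be written as the sum of two nonzero squares of integers, and let $z$ be a positive integer. Then $z\in\widehat{\mathcal{Z}}$ if and only if both of the following hold: (i) $z\in\mathcal{Z}$; and (ii) if $z$ is a perfect square, then $\sqrt{z}=(u^2+v^2)k$ for some integers $k>0$ and $u>v>0$ with $u,v$ of opposite parity and $\gcd(u,v)=1$.
   Context: $\mathcal{Z}$ denotes the set of all positive integers $z$ such that every prime factor $q$ of $z$ with $q\equiv 3\pmod 4$ has even exponent in the prime factorization of $z$ (equivalently, by Euler's theorem, the positive integers that are sums of two squares of integers, zero allowed). *)

theory Defs
  imports "HOL-Number_Theory.Number_Theory" "HOL-Computational_Algebra.Computational_Algebra"
begin

definition two_squares_Z :: "nat set" where
  "two_squares_Z = {z. 0 < z \<and>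
     (\<forall>q \<in> prime_factors z. [q = 3] (mod 4) \<longrightarrow> even (multiplicity q z))}"

definition two_nonzero_squares_Z :: "nat set" where
  "two_nonzero_squares_Z = {z. 0 < z \<and>
     (\<exists>a b :: int. a \<noteq> 0 \<and> b \<noteq> 0 \<and> int z = a\<^sup>2 + b\<^sup>2)}"

end

theory Submission
  imports Defs "HOL-Library.Discrete_Functions"
begin

text \<open>
  Since \<open>-1\<close> is a square modulo an odd prime \<open>p\<close> exactly when \<open>p \<equiv> 1 (mod 4)\<close>, a prime
  \<open>q \<equiv> 3 (mod 4)\<close> dividing \<open>a\<^sup>2 + b\<^sup>2\<close> divides both \<open>a\<close> and \<open>b\<close>, while Thue's pigeonhole argument
  makes a prime \<open>p \<equiv> 1 (mod 4)\<close> a sum of two squares; this gives the two-squares theorem.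
  Only a perfect square \<open>z = c\<^sup>2\<close> can fail to have a representation with both squares nonzero.
  If \<open>a\<^sup>2 + b\<^sup>2 = c\<^sup>2\<close> with \<open>a\<close>, \<open>b\<close> nonzero, then cancelling the prime factors of \<open>c\<close> that are \<open>2\<close>
  or \<open>\<equiv> 3 (mod 4)\<close>, which divide \<open>a\<close> and \<open>b\<close> as well, shows that \<open>c\<close> has a prime factor
  \<open>p \<equiv> 1 (mod 4)\<close>, and \<open>p = u\<^sup>2 + v\<^sup>2\<close> yields the required parametrization. This avoids the
  classification of Pythagorean triples; the converse is the identity
  \<open>(u\<^sup>2 + v\<^sup>2)\<^sup>2 = (u\<^sup>2 - v\<^sup>2)\<^sup>2 + (2uv)\<^sup>2\<close>.
\<close>

section \<open>\<open>-1\<close> as a quadratic residue, and primes dividing a sum of two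
  squares\<close>

lemma QuadRes_minus_one_iff:
  fixes p :: nat
  assumes "prime p" "2 < p"
  shows "QuadRes (int p) (-1) \<longleftrightarrow> [p = 1] (mod 4)"
proof -
  have odd: "odd p"
    using assms prime_odd_nat by blast
  \<comment> \<open>Since \<open>p > 2\<close>, the signs 1 and -1 stay distinct modulo
    \<open>p\<close>; this turns the congruence of Euler's criterion into an equality of
    integers.\<close>
  have cong_unit_eq: "x = y" if "[x = y] (mod int p)" "x \<in> {1, -1}" "y \<in> {1, -1}" for x y :: int
  proof -
    have "int p dvd x - y"
      using that(1) by (simp add: cong_iff_dvd_diff)
    moreover have "\<bar>x - y\<bar> < int p"
      using that(2,3) assms(2) by auto
    ultimately show ?thesis
      using zdvd_not_zless[of "\<bar>x - y\<bar>" "int p"] by auto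
  qed
  have "\<not> [-1 = 0] (mod int p)"
    using assms(2) by (auto simp: cong_iff_dvd_diff dest: zdvd_imp_le)
  then have L: "Legendre (-1) (int p) = (if QuadRes (int p) (-1) then 1 else -1)"
    by (simp add: Legendre_def)
  have "[Legendre (-1) (int p) = (-1) ^ ((p - 1) div 2)] (mod int p)"
    using assms by (rule euler_criterion)
  then have "Legendre (-1) (int p) = (-1) ^ ((p - 1) div 2)"
    by (rule cong_unit_eq) (auto simp: L minus_one_power_iff)
  then have "QuadRes (int p) (-1) \<longleftrightarrow> even ((p - 1) div 2)"
    by (auto simp: L minus_one_power_iff split: if_splits)
  also have "\<dots> \<longleftrightarrow> [p = 1] (mod 4)"
    using odd unfolding cong_def by presburger
  finally show ?thesis .
qed

lemma prime_3_mod_4_dvd_left: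
  fixes p :: nat and a b :: int
  assumes p: "prime p" "[p = 3] (mod 4)" and dvd: "int p dvd a\<^sup>2 + b\<^sup>2"
  shows "int p dvd b"
proof (rule ccontr)
  assume "\<not> int p dvd b"
  then have "coprime b (int p)"
    using p(1) by (metis coprime_commute prime_imp_coprime prime_nat_int_transfer)
  \<comment> \<open>Multiplying \<open>a\<^sup>2 + b\<^sup>2\<close> by the square of the inverse
    \<open>c\<close> of \<open>b\<close> exhibits \<open>a * c\<close> as a square root of
    -1.\<close>
  then obtain c where c: "[b * c = 1] (mod int p)"
    using cong_solve_coprime_int by blast
  have "[(a\<^sup>2 + b\<^sup>2) * c\<^sup>2 - (b * c)\<^sup>2 = 0 * c\<^sup>2 - 1\<^sup>2] (mod int p)"
    using dvd c by (intro cong_diff cong_mult cong_pow cong_refl) (auto simp: cong_0_iff)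
  then have "[(a * c)\<^sup>2 = -1] (mod int p)"
    by (simp add: algebra_simps power_mult_distrib)
  then have "QuadRes (int p) (-1)"
    unfolding QuadRes_def by blast
  moreover have "2 < p"
    using p prime_ge_2_nat[OF p(1)] by (cases "p = 2") (auto simp: cong_def)
  ultimately show False
    using QuadRes_minus_one_iff[OF p(1)] p(2) by (simp add: cong_def)
qed

lemma prime_3_mod_4_dvd_sum_squares:
  fixes p :: nat and a b :: int
  assumes "prime p" "[p = 3] (mod 4)" "int p dvd a\<^sup>2 + b\<^sup>2"
  shows "int p dvd a" "int p dvd b"
  using prime_3_mod_4_dvd_left[of p a b] prime_3_mod_4_dvd_left[of p b a] assms
  by (simp_all add: add.commute)

lemma prime_mod_4_cases:
  fixes p :: nat
  assumes "prime p"
  obtains "p = 2" | "[p = 1] (mod 4)" | "[p = 3] (mod 4)"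
proof -
  have "p = 2 \<or> odd p"
    using assms prime_odd_nat prime_ge_2_nat[OF assms] by (metis le_neq_implies_less)
  moreover have "p mod 4 = 1 \<or> p mod 4 = 3" if "odd p"
    using that by presburger
  ultimately show ?thesis
    using that by (auto simp: cong_def)
qed

section \<open>Primes congruent to 1 modulo 4 as sums of two squares\<close>

lemma prime_1_mod_4_sum_squares:
  fixes p :: nat
  assumes p: "prime p" "[p = 1] (mod 4)"
  shows "\<exists>a b :: int. int p = a\<^sup>2 + b\<^sup>2"
proof -
  have p2: "2 < p"
    using p prime_ge_2_nat[OF p(1)] by (cases "p = 2") (auto simp: cong_def)
  then obtain x :: int where x: "[x\<^sup>2 = -1] (mod int p)"
    using QuadRes_minus_one_iff[OF p(1)] p(2) unfolding QuadRes_def by blast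
  define s where "s = floor_sqrt p"
  have s_sq: "s\<^sup>2 \<le> p" "p < (Suc s)\<^sup>2"
    by (simp_all add: s_def Suc_floor_sqrt_power2_gt del: power_Suc)
  \<comment> \<open>The strict inequality is what later gives
    \<open>d\<^sup>2 + e\<^sup>2 < 2 * p\<close>, leaving \<open>p\<close> as the only positive
    multiple possible.\<close>
  have "s\<^sup>2 \<noteq> p"
    using p(1) prime_power_iff[of s 2] by auto
  with s_sq(1) have s_less: "(int s)\<^sup>2 < int p"
    by (simp flip: of_nat_power)
  \<comment> \<open>Thue's argument: more than \<open>p\<close> pairs \<open>(i, j)\<close> compete for \<open>p\<close> residues \<open>i - x j\<close>.\<close>
  define S where "S = {0..int s} \<times> {0..int s}"
  define f where "f = (\<lambda>(i, j). (i - x * j) mod int p)"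
  have "f ` S \<subseteq> {0..<int p}"
    using p2 by (auto simp: f_def)
  then have "card (f ` S) \<le> p"
    using card_mono[of "{0..<int p}" "f ` S"] by simp
  also have "p < card S"
    using s_sq(2) by (simp add: S_def card_cartesian_product power2_eq_square nat_add_distrib)
  finally have "\<not> inj_on f S"
    using pigeonhole by blast
  then obtain i j i' j' where ij: "(i, j) \<in> S" "(i', j') \<in> S" "(i, j) \<noteq> (i', j')"
      and eq: "f (i, j) = f (i', j')"
    unfolding inj_on_def by auto
  define d e where "d = i - i'" and "e = j - j'"
  have "[i - x * j = i' - x * j'] (mod int p)"
    using eq by (simp add: f_def cong_def)
  then have "int p dvd d - x * e"
    by (simp add: cong_iff_dvd_diff d_def e_def algebra_simps)
  moreover have "int p dvd x\<^sup>2 + 1"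
    using x by (simp add: cong_iff_dvd_diff)
  \<comment> \<open>Modulo \<open>p\<close>, \<open>d\<close> is \<open>x * e\<close> and
    \<open>x\<^sup>2\<close> is -1, so each product on the right vanishes.\<close>
  moreover have "d\<^sup>2 + e\<^sup>2 = (d - x * e) * (d + x * e) + (x\<^sup>2 + 1) * e\<^sup>2"
    by (simp add: algebra_simps power2_eq_square)
  ultimately have "int p dvd d\<^sup>2 + e\<^sup>2"
    by simp
  then obtain m where m: "d\<^sup>2 + e\<^sup>2 = int p * m" ..
  have "\<bar>d\<bar> \<le> int s" "\<bar>e\<bar> \<le> int s"
    using ij unfolding S_def d_def e_def by auto
  then have "d\<^sup>2 \<le> (int s)\<^sup>2" "e\<^sup>2 \<le> (int s)\<^sup>2"
    using abs_le_square_iff[of _ "int s"] by simp_all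
  then have "int p * m < int p * 2"
    using s_less m by linarith
  then have "m < 2"
    using p2 by simp
  have "0 < d\<^sup>2 + e\<^sup>2"
    using ij(3) by (auto simp: d_def e_def sum_power2_gt_zero_iff)
  then have "0 < m"
    using p2 unfolding m by (simp add: zero_less_mult_iff)
  with \<open>m < 2\<close> have "m = 1"
    by simp
  with m show ?thesis
    by (metis mult_1_right)
qed

section \<open>The two-squares theorem\<close>

text \<open>The Brahmagupta-Fibonacci identity, that is, multiplicativity of the norm of
  \<open>a + b i\<close>.\<close>

lemma sum_squares_mult:
  fixes a b c d :: "'a :: comm_ring_1"
  shows "(a\<^sup>2 + b\<^sup>2) * (c\<^sup>2 + d\<^sup>2) = (a * c - b * d)\<^sup>2 + (a * d + b * c)\<^sup>2"
  by (simp add: algebra_simps power2_eq_square)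

text \<open>Primes not dividing \<open>z > 0\<close> have multiplicity 0, which is even, so the
  condition may range over all primes.\<close>

lemma two_squares_Z_iff:
  "z \<in> two_squares_Z \<longleftrightarrow>
    0 < z \<and> (\<forall>q. prime q \<and> [q = 3] (mod 4) \<longrightarrow> even (multiplicity q z))"
  unfolding two_squares_Z_def prime_factors_multiplicity
  by (cases "z = 0") (auto, metis even_zero gr0I)

lemma two_squares_Z_mult_iff:
  fixes p m :: nat
  assumes "prime p" "\<not> [p = 3] (mod 4)"
  shows "p * m \<in> two_squares_Z \<longleftrightarrow> m \<in> two_squares_Z"
proof -
  have "multiplicity q (p * m) = multiplicity q m" if "prime q" "[q = 3] (mod 4)" "0 < m" for q
    using that assms
    by (subst prime_elem_multiplicity_mult_distrib)
       (auto simp: prime_gt_0_nat intro!: not_dvd_imp_multiplicity_0 dest: primes_dvd_imp_eq)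
  then show ?thesis
    using assms(1) by (auto simp: two_squares_Z_iff prime_gt_0_nat)
qed

lemma two_squares_Z_square_mult_iff:
  fixes p m :: nat
  assumes "prime p"
  shows "p\<^sup>2 * m \<in> two_squares_Z \<longleftrightarrow> m \<in> two_squares_Z"
proof -
  have "even (multiplicity q (p\<^sup>2 * m)) \<longleftrightarrow> even (multiplicity q m)" if "prime q" "0 < m" for q
    using that assms
    by (subst prime_elem_multiplicity_mult_distrib)
       (auto simp: prime_elem_multiplicity_power_distrib)
  then show ?thesis
    using assms(1) by (auto simp: two_squares_Z_iff prime_gt_0_nat)
qed

text \<open>Strong induction, removing \<open>p\<^sup>2\<close> when the chosen prime factor is 3
  modulo 4 and a single \<open>p\<close> otherwise. The first is restored by scaling both entries by
  \<open>p\<close>, the second by composing representations.\<close>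

lemma two_squares_Z_imp_sum_squares:
  "z \<in> two_squares_Z \<Longrightarrow> \<exists>a b :: int. int z = a\<^sup>2 + b\<^sup>2"
proof (induction z rule: less_induct)
  case (less z)
  have "0 < z"
    using less.prems by (simp add: two_squares_Z_iff)
  show ?case
  proof (cases "z = 1")
    case True
    then show ?thesis
      by (intro exI[of _ 1] exI[of _ 0]) simp
  next
    case False
    then obtain p where p: "prime p" "p dvd z"
      using prime_factor_nat by blast
    show ?thesis
    proof (cases "[p = 3] (mod 4)")
      case True
      have "multiplicity p z \<noteq> 0"
        using p \<open>0 < z\<close> by (simp add: prime_multiplicity_gt_zero_iff)
      moreover have "even (multiplicity p z)"
        using less.prems p(1) True by (simp add: two_squares_Z_iff)
      ultimately have "2 \<le> multiplicity p z"
        by presburger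
      then obtain m where z: "z = p\<^sup>2 * m"
        using multiplicity_dvd' by blast
      have "1 < p\<^sup>2"
        using prime_gt_1_nat[OF p(1)] by (rule one_less_power) simp
      then have "m < z"
        using \<open>0 < z\<close> by (simp add: z)
      moreover have "m \<in> two_squares_Z"
        using less.prems p(1) by (simp add: z two_squares_Z_square_mult_iff)
      ultimately obtain a b where "int m = a\<^sup>2 + b\<^sup>2"
        using less.IH by blast
      then have "int z = (int p * a)\<^sup>2 + (int p * b)\<^sup>2"
        by (simp add: z algebra_simps power_mult_distrib)
      then show ?thesis
        by blast
    next
      case not3: False
      obtain m where z: "z = p * m"
        using p(2) ..
      have "m < z"
        using \<open>0 < z\<close> prime_gt_1_nat[OF p(1)] by (simp add: z)
      moreover have "m \<in> two_squares_Z"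
        using less.prems p(1) not3 by (simp add: z two_squares_Z_mult_iff)
      ultimately obtain a b where ab: "int m = a\<^sup>2 + b\<^sup>2"
        using less.IH by blast
      have "\<exists>c d :: int. int p = c\<^sup>2 + d\<^sup>2"
        using p(1)
      proof (cases rule: prime_mod_4_cases)
        case 1
        then show ?thesis
          by (intro exI[of _ 1]) simp
      qed (use p(1) not3 prime_1_mod_4_sum_squares in auto)
      then obtain c d where "int p = c\<^sup>2 + d\<^sup>2"
        by blast
      then have "int z = (c * a - d * b)\<^sup>2 + (c * b + d * a)\<^sup>2"
        by (simp add: z ab sum_squares_mult)
      then show ?thesis
        by blast
    qed
  qed
qed

text \<open>Descent: a prime factor that is 3 modulo 4 divides both entries, so dividing by its
  square leaves a smaller sum of two squares. Without such a factor, all multiplicities in question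
  are 0.\<close>

lemma sum_squares_in_two_squares_Z:
  fixes a b :: int
  shows "0 < z \<Longrightarrow> int z = a\<^sup>2 + b\<^sup>2 \<Longrightarrow> z \<in> two_squares_Z"
proof (induction z arbitrary: a b rule: less_induct)
  case (less z)
  show ?case
  proof (cases "\<exists>p. prime p \<and> [p = 3] (mod 4) \<and> p dvd z")
    case True
    then obtain p where p: "prime p" "[p = 3] (mod 4)" "p dvd z"
      by blast
    then have "int p dvd a\<^sup>2 + b\<^sup>2"
      using less.prems(2) by (metis int_dvd_int_iff)
    then obtain c d where cd: "a = int p * c" "b = int p * d"
      using prime_3_mod_4_dvd_sum_squares[OF p(1,2)] by (meson dvdE)
    define m where "m = nat (c\<^sup>2 + d\<^sup>2)"
    have m: "int m = c\<^sup>2 + d\<^sup>2"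
      by (simp add: m_def)
    have "int z = int (p\<^sup>2 * m)"
      using less.prems(2) by (simp add: m cd algebra_simps power_mult_distrib)
    then have z: "z = p\<^sup>2 * m"
      using of_nat_eq_iff by blast
    have "1 < p\<^sup>2"
      using prime_gt_1_nat[OF p(1)] by (rule one_less_power) simp
    then have "0 < m" "m < z"
      using less.prems(1) by (simp_all add: z)
    then show ?thesis
      using less.IH m p(1) by (simp add: z two_squares_Z_square_mult_iff)
  next
    case False
    then show ?thesis
      using less.prems(1) by (auto simp: two_squares_Z_iff not_dvd_imp_multiplicity_0)
  qed
qed

section \<open>Squares that are sums of two nonzero squares\<close>

text \<open>Squares are 0 or 1 modulo 4, so two of them add up to 0 only if both are 0.\<close>

lemma even_sum_squares_eq_square:
  fixes a b c :: int
  assumes "a\<^sup>2 + b\<^sup>2 = c\<^sup>2" "even c"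
  shows "even a" "even b"
proof -
  have sq: "x\<^sup>2 mod 4 = (if even x then 0 else 1)" for x :: int
  proof (cases "even x")
    case True
    then show ?thesis
      by (auto elim!: evenE simp: power2_eq_square)
  next
    case False
    then obtain k where "x = 2 * k + 1" ..
    then have "x\<^sup>2 = 4 * (k\<^sup>2 + k) + 1"
      by (simp add: power2_eq_square algebra_simps)
    with False show ?thesis
      by presburger
  qed
  have "(a\<^sup>2 mod 4 + b\<^sup>2 mod 4) mod 4 = 0"
    using assms sq[of c] by (simp add: mod_add_eq)
  then show "even a" "even b"
    unfolding sq by (auto split: if_splits)
qed

lemma sum_squares_eq_square_imp_prime_1_mod_4:
  fixes a b :: int
  shows "0 < c \<Longrightarrow> a\<^sup>2 + b\<^sup>2 = (int c)\<^sup>2 \<Longrightarrow> a \<noteq> 0 \<Longrightarrow> b \<noteq> 0 \<Longrightarrow>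
    \<exists>p. prime p \<and> p dvd c \<and> [p = 1] (mod 4)"
proof (induction c arbitrary: a b rule: less_induct)
  case (less c)
  \<comment> \<open>Two positive squares add up to at least 2, which rules out \<open>c = 1\<close>
    and stops the descent.\<close>
  have "0 < a\<^sup>2" "0 < b\<^sup>2"
    using less.prems by auto
  then have "(int c)\<^sup>2 \<noteq> 1"
    using less.prems(2) by linarith
  then have "c \<noteq> 1"
    by auto
  then obtain p where p: "prime p" "p dvd c"
    using prime_factor_nat by blast
  show ?case
  proof (cases "[p = 1] (mod 4)")
    case True
    then show ?thesis
      using p by blast
  next
    case False
    have "int p dvd a \<and> int p dvd b"
      using p(1)
    proof (cases rule: prime_mod_4_cases)
      case 1
      then show ?thesis
        using even_sum_squares_eq_square[OF less.prems(2)] p(2) by auto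
    next
      case 3
      have "int p dvd a\<^sup>2 + b\<^sup>2"
        using p(2) unfolding less.prems(2) by (simp add: power2_eq_square)
      then show ?thesis
        using prime_3_mod_4_dvd_sum_squares[OF p(1) 3] by blast
    qed (use False in simp)
    then obtain a' b' where ab: "a = int p * a'" "b = int p * b'"
      unfolding dvd_def by blast
    obtain m where c: "c = p * m"
      using p(2) ..
    have "(int p)\<^sup>2 * (a'\<^sup>2 + b'\<^sup>2) = (int p)\<^sup>2 * (int m)\<^sup>2"
      using less.prems(2) by (simp add: ab c algebra_simps power_mult_distrib)
    then have "a'\<^sup>2 + b'\<^sup>2 = (int m)\<^sup>2"
      using p(1) by (simp add: prime_gt_0_nat)
    moreover have "0 < m" "m < c"
      using less.prems(1) prime_gt_1_nat[OF p(1)] by (simp_all add: c)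
    ultimately show ?thesis
      using less.IH[of m a' b'] less.prems(3,4) by (auto simp: ab c)
  qed
qed

lemma prime_1_mod_4_coprime_sum_squares:
  fixes p :: nat
  assumes p: "prime p" "[p = 1] (mod 4)"
  obtains u v :: int where
    "0 < v" "v < u" "even u \<noteq> even v" "gcd u v = 1" "int p = u\<^sup>2 + v\<^sup>2"
proof -
  obtain a b :: int where ab: "int p = a\<^sup>2 + b\<^sup>2"
    using prime_1_mod_4_sum_squares[OF p] by blast
  define u v where "u = max \<bar>a\<bar> \<bar>b\<bar>" and "v = min \<bar>a\<bar> \<bar>b\<bar>"
  have uv: "int p = u\<^sup>2 + v\<^sup>2"
    using ab by (auto simp: u_def v_def max_def min_def)
  have "odd p"
    using p(2) unfolding cong_def by presburger
  then have "odd (u\<^sup>2 + v\<^sup>2)"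
    using uv by (metis even_of_nat)
  then have parity: "even u \<noteq> even v"
    by simp
  have "gcd u v = 1"
  proof -
    \<comment> \<open>The square of the gcd divides the prime \<open>p\<close>, which is
      squarefree.\<close>
    define g where "g = gcd u v"
    have "g\<^sup>2 dvd int p"
      unfolding uv g_def by (intro dvd_add dvd_power_same) auto
    then have "(nat g)\<^sup>2 dvd p"
      by (simp add: g_def nat_dvd_iff flip: int_dvd_int_iff)
    then have "nat g = 1"
      using p(1) squarefree_prime[of p] unfolding squarefree_def by auto
    then show ?thesis
      by (simp add: g_def)
  qed
  moreover have "v \<noteq> 0"
  proof
    assume "v = 0"
    then have "int p = int ((nat u)\<^sup>2)"
      using uv by (simp add: u_def)
    then have "p = (nat u)\<^sup>2"
      using of_nat_eq_iff by blast
    then show False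
      using p(1) prime_power_iff[of "nat u" 2] by auto
  qed
  moreover have "0 \<le> v" "v \<le> u"
    by (auto simp: u_def v_def)
  moreover have "u \<noteq> v"
    using parity by blast
  ultimately show ?thesis
    using that[of v u] parity uv by linarith
qed

theorem theorem1p7:
  fixes z :: nat
  assumes "0 < z"
  shows "z \<in> two_nonzero_squares_Z \<longleftrightarrow>
    z \<in> two_squares_Z \<and>
    (is_square z \<longrightarrow>
      (\<exists>k u v :: int. 0 < k \<and> 0 < v \<and> v < u \<and> even u \<noteq> even v \<and> gcd u v = 1 \<and>
         sqrt (real z) = of_int ((u\<^sup>2 + v\<^sup>2) * k)))"
    (is "_ \<longleftrightarrow> _ \<and> (_ \<longrightarrow> ?param)")
proof (intro iffI conjI impI)
  assume "z \<in> two_nonzero_squares_Z"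
  then obtain a b :: int where ab: "a \<noteq> 0" "b \<noteq> 0" "int z = a\<^sup>2 + b\<^sup>2"
    by (auto simp: two_nonzero_squares_Z_def)
  show "z \<in> two_squares_Z"
    using assms ab(3) by (rule sum_squares_in_two_squares_Z)
  assume "is_square z"
  then obtain c where c: "z = c\<^sup>2"
    by (auto simp: is_nth_power_def)
  have "0 < c"
    using assms c by simp
  have "a\<^sup>2 + b\<^sup>2 = (int c)\<^sup>2"
    using ab(3) by (simp add: c)
  with \<open>0 < c\<close> ab(1,2) obtain p where p: "prime p" "p dvd c" "[p = 1] (mod 4)"
    using sum_squares_eq_square_imp_prime_1_mod_4 by blast
  obtain u v :: int where uv: "0 < v" "v < u" "even u \<noteq> even v" "gcd u v = 1" "int p = u\<^sup>2 + v\<^sup>2"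
    using p(1,3) by (rule prime_1_mod_4_coprime_sum_squares)
  obtain k where k: "c = p * k"
    using p(2) ..
  have "sqrt (real z) = of_int (int c)"
    by (simp add: c)
  also have "int c = (u\<^sup>2 + v\<^sup>2) * int k"
    by (simp add: k uv(5))
  finally have "sqrt (real z) = of_int ((u\<^sup>2 + v\<^sup>2) * int k)" .
  moreover have "0 < int k"
    using \<open>0 < c\<close> k by simp
  ultimately show ?param
    using uv(1-4) by (intro exI[of _ "int k"] exI[of _ u] exI[of _ v]) simp
next
  assume R: "z \<in> two_squares_Z \<and> (is_square z \<longrightarrow> ?param)"
  show "z \<in> two_nonzero_squares_Z"
  proof (cases "is_square z")
    case True
    with R obtain k u v :: int where kuv: "0 < k" "0 < v" "v < u"
        and sqrt: "sqrt (real z) = of_int ((u\<^sup>2 + v\<^sup>2) * k)"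
      by blast
    \<comment> \<open>Squaring removes the root and brings the equation back to the
      integers.\<close>
    have "real z = (sqrt (real z))\<^sup>2"
      by simp
    also have "\<dots> = of_int (((u\<^sup>2 + v\<^sup>2) * k)\<^sup>2)"
      unfolding sqrt by simp
    finally have "of_int (int z) = (of_int (((u\<^sup>2 + v\<^sup>2) * k)\<^sup>2) :: real)"
      by simp
    then have "int z = ((u\<^sup>2 + v\<^sup>2) * k)\<^sup>2"
      by (rule of_int_eq_iff[THEN iffD1])
    also have "\<dots> = ((u\<^sup>2 - v\<^sup>2) * k)\<^sup>2 + (2 * u * v * k)\<^sup>2"
      by (simp add: power2_eq_square algebra_simps)
    finally have "int z = ((u\<^sup>2 - v\<^sup>2) * k)\<^sup>2 + (2 * u * v * k)\<^sup>2" .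
    moreover have "v\<^sup>2 < u\<^sup>2"
      using kuv by (simp add: power_strict_mono)
    then have "(u\<^sup>2 - v\<^sup>2) * k \<noteq> 0" "2 * u * v * k \<noteq> 0"
      using kuv by auto
    ultimately show ?thesis
      using assms unfolding two_nonzero_squares_Z_def by blast
  next
    case False
    obtain a b :: int where ab: "int z = a\<^sup>2 + b\<^sup>2"
      using R two_squares_Z_imp_sum_squares by blast
    \<comment> \<open>A zero entry would make \<open>z\<close> a square, so any representation of a
      nonsquare has both entries nonzero.\<close>
    have "int z \<noteq> x\<^sup>2" for x :: int
    proof
      assume "int z = x\<^sup>2"
      then have "int z = int ((nat \<bar>x\<bar>)\<^sup>2)"
        by simp
      then have "z = (nat \<bar>x\<bar>)\<^sup>2"
        using of_nat_eq_iff by blast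
      with False show False
        by simp
    qed
    from this[of a] this[of b] have "a \<noteq> 0" "b \<noteq> 0"
      using ab by auto
    then show ?thesis
      using assms ab unfolding two_nonzero_squares_Z_def by blast
  qed
qed

end
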